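(* Let $R$ be a Dedekind domain, let $P$ be a nonzero prime ideal of $R$ such that $R/P$ is finite, and let $\alpha$ be a positive integer. Then $s\chi(G_{R/P^{\alpha}})=|R/P|^{\alpha}$.
   Context: $G_{R/P^\alpha}$ is the unitary Cayley graph of $R/P^\alpha$: vertex set $R/P^\alpha$, with $a,b$ adjacent iff $a-b$ is a unit. For a positive integer $k$ and a graph $G$ with $n$ vertices, let $\ell$ be the least nonnegative integer with $k\mid \ell+n$ and let $H$ be $G$ with $\ell$ isolated vertices added; $G$ is strongly $k$-colorable if for every partition of the vertices of $H$ into subsets of size $k$, there is a proper vertex coloring of $H$ in which each color appears exactly once in each subset of the partition. The strong chromatic number $s\chi(G)$ is the least $k$ such that $G$ is strongly $k$-colorable. *)

theory Defs
  imports
    "HOL-Algebra.Algebra"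
    "HOL-Library.Disjoint_Sets"
    "Graph_Theory.Pair_Digraph"
begin

section \<open>Dedekind domains\<close>

definition is_fraction_field ::
  "('a, 'b) ring_scheme \<Rightarrow> ('c, 'd) ring_scheme \<Rightarrow> ('a \<Rightarrow> 'c) \<Rightarrow> bool" where
  "is_fraction_field R K \<phi> \<longleftrightarrow>
     field K \<and> \<phi> \<in> ring_hom R K \<and> inj_on \<phi> (carrier R) \<and>
     (\<forall>x \<in> carrier K. \<exists>a \<in> carrier R. \<exists>b \<in> carrier R - {\<zero>\<^bsub>R\<^esub>}.
        x = \<phi> a \<otimes>\<^bsub>K\<^esub> inv\<^bsub>K\<^esub> (\<phi> b))"

text \<open>HOL-Algebra represents polynomials by coefficient lists, leading coefficient first,
  so a polynomial is monic iff it is a nonempty list with head one.\<close>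

definition integral_over :: "('c, 'd) ring_scheme \<Rightarrow> 'c set \<Rightarrow> 'c \<Rightarrow> bool" where
  "integral_over K S x \<longleftrightarrow>
     (\<exists>p \<in> carrier (univ_poly K S). p \<noteq> [] \<and> hd p = \<one>\<^bsub>K\<^esub> \<and> ring.eval K p x = \<zero>\<^bsub>K\<^esub>)"

text \<open>A field of fractions is unique up to isomorphism over \<open>R\<close>, so it does not matter which one is
  taken. The type of \<open>K\<close> below is that of the usual construction, whose elements are
  equivalence classes of pairs of elements of \<open>R\<close>, so one always exists at this type.\<close>

definition integrally_closed :: "('a, 'b) ring_scheme \<Rightarrow> bool" where
  "integrally_closed R \<longleftrightarrow>
     (\<exists>(K :: ('a \<times> 'a) set ring) \<phi>. is_fraction_field R K \<phi> \<and>
        (\<forall>x \<in> carrier K. integral_over K (\<phi> ` carrier R) x \<longrightarrow> x \<in> \<phi> ` carrier R))"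

text \<open>Fields are included, as in many textbooks; a field has no nonzero prime ideal.\<close>

definition dedekind_domain :: "('a, 'b) ring_scheme \<Rightarrow> bool" where
  "dedekind_domain R \<longleftrightarrow>
     noetherian_domain R \<and> integrally_closed R \<and>
     (\<forall>P. primeideal P R \<and> P \<noteq> {\<zero>\<^bsub>R\<^esub>} \<longrightarrow> maximalideal P R)"

section \<open>Unitary Cayley graphs\<close>

text \<open>A graph is a \<^typ>\<open>'v pair_pre_digraph\<close> whose arc relation is symmetric, each edge
  being represented by its two orientations.\<close>

definition unitary_cayley_graph :: "('a, 'b) ring_scheme \<Rightarrow> 'a pair_pre_digraph" where
  "unitary_cayley_graph R =
     \<lparr> pverts = carrier R,
       parcs = {(a, b). a \<in> carrier R \<and> b \<in> carrier R \<and> a \<ominus>\<^bsub>R\<^esub> b \<in> Units R} \<rparr>"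

section \<open>The strong chromatic number\<close>

definition add_isolated :: "'v pair_pre_digraph \<Rightarrow> nat \<Rightarrow> ('v + nat) pair_pre_digraph" where
  "add_isolated G l =
     \<lparr> pverts = pverts G <+> {..<l}, parcs = {(Inl u, Inl v) | u v. (u, v) \<in> parcs G} \<rparr>"

definition proper_coloring :: "'v pair_pre_digraph \<Rightarrow> ('v \<Rightarrow> nat) \<Rightarrow> bool" where
  "proper_coloring G c \<longleftrightarrow> (\<forall>(u, v) \<in> parcs G. c u \<noteq> c v)"

text \<open>For finite graphs. The colors are the values \<open>c\<close> takes on the vertices; if there
  are any vertices, the condition on \<open>c\<close> forces their number to be \<open>k\<close>.\<close>

definition strongly_colorable :: "'v pair_pre_digraph \<Rightarrow> nat \<Rightarrow> bool" where
  "strongly_colorable G k \<longleftrightarrow>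
     (let l = (LEAST l. k dvd l + card (pverts G));
          H = add_isolated G l
      in \<forall>\<P>. partition_on (pverts H) \<P> \<and> (\<forall>S \<in> \<P>. card S = k) \<longrightarrow>
           (\<exists>c. proper_coloring H c \<and>
                (\<forall>x \<in> c ` pverts H. \<forall>S \<in> \<P>. \<exists>!v. v \<in> S \<and> c v = x)))"

definition strong_chromatic_number :: "'v pair_pre_digraph \<Rightarrow> nat" where
  "strong_chromatic_number G = (LEAST k. k > 0 \<and> strongly_colorable G k)"

end

theory Submission
  imports Defs
begin

text \<open>The ring \<open>R/P\<^sup>\<alpha>\<close> is local with maximal ideal \<open>P/P\<^sup>\<alpha>\<close>, so its unitary Cayley graph is complete
  multipartite, the parts being the cosets of \<open>P/P\<^sup>\<alpha>\<close>; these all have the same size \<open>m\<close>. Let \<open>n\<close>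
  be the number of vertices. With \<open>n\<close> colors every injective coloring works. If \<open>0 < k < n\<close>, there
  are sets \<open>A\<close> and \<open>B\<close> of at most \<open>k\<close> vertices each, with \<open>k < |A| + |B|\<close>, such that every vertex of
  \<open>A\<close> is adjacent to every vertex of \<open>B\<close>: for \<open>m \<le> k\<close> take \<open>\<lfloor>k/m\<rfloor>\<close> parts and one further part, for
  \<open>k < m\<close> take \<open>k\<close> vertices of one part and one vertex of another. Placing \<open>A\<close> and \<open>B\<close> in different
  blocks of the partition makes a coloring impossible.

  That \<open>n = |R/P|\<^sup>\<alpha>\<close> follows from \<open>P\<close> being locally principal: there are \<open>p \<in> P\<close> and \<open>u \<notin> P\<close> with
  \<open>uP \<subseteq> pR\<close>, and then multiplication by \<open>p\<^sup>i\<close> induces a bijection from \<open>R/P\<close> to \<open>P\<^sup>i/P\<^sup>i\<^sup>+\<^sup>1\<close>.\<close>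

section \<open>Strong colorings of complete multipartite graphs\<close>

lemma exists_partition_on_card:
  assumes "finite V" "k dvd card V" "k > 0"
  shows "\<exists>\<P>. partition_on V \<P> \<and> (\<forall>S\<in>\<P>. card S = k)"
  using assms
proof (induction "card V" arbitrary: V rule: less_induct)
  case less
  show ?case
  proof (cases "V = {}")
    case True
    then show ?thesis by (auto intro!: exI[of _ "{}"] simp: partition_on_empty)
  next
    case False
    with less.prems have "k \<le> card V"
      by (meson card_gt_0_iff dvd_imp_le)
    then obtain S where S: "S \<subseteq> V" "card S = k"
      by (meson obtain_subset_with_card_n)
    have card: "card (V - S) = card V - k"
      using S less.prems(1) by (simp add: card_Diff_subset finite_subset)
    have "\<exists>\<P>. partition_on (V - S) \<P> \<and> (\<forall>S\<in>\<P>. card S = k)"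
      using less.hyps[of "V - S"] less.prems \<open>k \<le> card V\<close> by (simp add: card)
    then obtain \<P> where \<P>: "partition_on (V - S) \<P>" "\<forall>S\<in>\<P>. card S = k"
      by blast
    have "S \<noteq> {}"
      using S \<open>k > 0\<close> by auto
    moreover have "disjnt S (\<Union>\<P>)"
      using partition_onD1[OF \<P>(1)] by (auto simp: disjnt_def)
    ultimately have "partition_on V (insert S \<P>)"
      using \<P> S by (simp add: partition_on_insert)
    with \<P> S show ?thesis by blast
  qed
qed

text \<open>Being a multiple of \<open>k\<close> larger than \<open>k\<close>, \<open>card V\<close>
  is at least \<open>2 * k\<close>. This leaves room for two disjoint blocks, one grown from
  \<open>A\<close> inside \<open>V - B\<close>, the other from \<open>B\<close> in what is left; the
  number of remaining elements is still divisible by \<open>k\<close>.\<close>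

lemma exists_partition_on_card_separating:
  assumes V: "finite V" "k dvd card V" and k: "0 < k" "k < card V"
    and AB: "A \<subseteq> V" "B \<subseteq> V" "A \<inter> B = {}" "card A \<le> k" "card B \<le> k"
  obtains \<P> S T where "partition_on V \<P>" "\<forall>S\<in>\<P>. card S = k"
    "S \<in> \<P>" "T \<in> \<P>" "A \<subseteq> S" "B \<subseteq> T"
proof -
  have "2 * k \<le> card V"
  proof -
    obtain t where t: "card V = k * t"
      using V(2) by blast
    then have "t \<noteq> 0" "t \<noteq> 1"
      using k by auto
    then have "2 \<le> t"
      by linarith
    then show ?thesis
      by (simp add: t)
  qed
  have "card (V - B) = card V - card B"
    using V AB by (simp add: card_Diff_subset finite_subset)
  with AB \<open>2 * k \<le> card V\<close> have "k \<le> card (V - B)" "A \<subseteq> V - B"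
    by auto
  then obtain S where S: "A \<subseteq> S" "S \<subseteq> V - B" "card S = k"
    using exists_subset_between[of A k "V - B"] V AB by blast
  have cVS: "card (V - S) = card V - k"
    using V S by (metis Diff_subset card_Diff_subset finite_subset order_trans)
  with AB S \<open>2 * k \<le> card V\<close> have "k \<le> card (V - S)" "B \<subseteq> V - S"
    by auto
  then obtain T where T: "B \<subseteq> T" "T \<subseteq> V - S" "card T = k"
    using exists_subset_between[of B k "V - S"] V AB by blast
  have "card (V - S - T) = card V - k - k"
    using V T cVS by (metis card_Diff_subset finite_Diff finite_subset)
  then have "k dvd card (V - S - T)"
    using V(2) by simp
  then obtain \<P> where \<P>: "partition_on (V - S - T) \<P>" "\<forall>S\<in>\<P>. card S = k"
    using exists_partition_on_card[of "V - S - T" k] V k by auto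
  have "S \<noteq> {}" "T \<noteq> {}"
    using S T k by auto
  moreover have "disjnt T (\<Union>\<P>)" "disjnt S (\<Union>(insert T \<P>))"
    using partition_onD1[OF \<P>(1)] T by (auto simp: disjnt_def)
  moreover have "S \<subseteq> V"
    using S by blast
  ultimately have "partition_on V (insert S (insert T \<P>))"
    using \<P> T by (simp add: partition_on_insert)
  with \<P> S T show thesis
    by (intro that[of "insert S (insert T \<P>)" S T]) auto
qed

text \<open>Place \<open>A\<close> and \<open>B\<close> in two different blocks: a coloring as required is then injective on
  \<open>A \<union> B\<close>, but it uses only the \<open>k\<close> colors of a single block.\<close>

lemma not_strongly_colorable:
  assumes fin: "finite (pverts G)" and k: "0 < k" "k < card A + card B"
    and AB: "A \<subseteq> pverts G" "B \<subseteq> pverts G" "A \<inter> B = {}" "card A \<le> k" "card B \<le> k"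
    and arcs: "\<And>x y. x \<in> A \<Longrightarrow> y \<in> B \<Longrightarrow> (x, y) \<in> parcs G"
  shows "\<not> strongly_colorable G k"
proof
  assume sc: "strongly_colorable G k"
  define l where "l = (LEAST l. k dvd l + card (pverts G))"
  define H where "H = add_isolated G l"
  let ?A = "Inl ` A :: ('a + nat) set" and ?B = "Inl ` B :: ('a + nat) set"
  \<comment> \<open>\<open>LEAST\<close> is meaningful only once some admissible number of isolated
    vertices is exhibited.\<close>
  have "k dvd (k - 1) * card (pverts G) + card (pverts G)"
    using k by (cases k) (simp_all flip: mult_Suc add: add.commute)
  then have dvd: "k dvd l + card (pverts G)"
    unfolding l_def by (rule LeastI)
  have pH: "pverts H = pverts G <+> {..<l}"
    by (simp add: H_def add_isolated_def)
  have finH: "finite (pverts H)" and cardH: "card (pverts H) = l + card (pverts G)"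
    using fin by (auto simp: pH card_Plus)
  \<comment> \<open>This count puts \<open>k\<close> below the number of vertices of
    \<open>H\<close>, so there are at least two blocks.\<close>
  have "card A + card B = card (A \<union> B)"
    using AB fin by (metis card_Un_disjoint finite_subset)
  also have "\<dots> \<le> card (pverts G)"
    using AB fin by (simp add: card_mono)
  finally have kH: "k < card (pverts H)"
    using k cardH by simp
  obtain \<P> S T where \<P>: "partition_on (pverts H) \<P>" "\<forall>S\<in>\<P>. card S = k"
    and ST: "S \<in> \<P>" "T \<in> \<P>" "?A \<subseteq> S" "?B \<subseteq> T"
  proof (rule exists_partition_on_card_separating[of "pverts H" k ?A ?B])
    show "k dvd card (pverts H)"
      using dvd cardH by simp
    show "?A \<subseteq> pverts H" "?B \<subseteq> pverts H" "?A \<inter> ?B = {}"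
      using AB by (auto simp: pH)
    show "card ?A \<le> k" "card ?B \<le> k"
      using AB by (simp_all add: card_image)
  qed (use finH kH k in auto)
  note sc' = sc[unfolded strongly_colorable_def Let_def, folded l_def, folded H_def]
  obtain c where c: "proper_coloring H c"
    and all: "\<forall>x\<in>c ` pverts H. \<forall>S\<in>\<P>. \<exists>!v. v \<in> S \<and> c v = x"
    using sc'[THEN spec, THEN mp, OF conjI[OF \<P>]] by (elim exE conjE)
  note ex1 = all[THEN bspec, THEN bspec]
  have sub: "C \<subseteq> pverts H" if "C \<in> \<P>" for C
    using that \<P>(1) by (auto simp: partition_on_def)
  have inj: "inj_on c C" if "C \<in> \<P>" for C
    using ex1[OF _ that] sub[OF that] by (intro inj_onI) blast
  have "c u \<noteq> c v" if "u \<in> ?A" "v \<in> ?B" for u v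
    using c arcs that by (auto simp: proper_coloring_def H_def add_isolated_def)
  moreover have "inj_on c ?A" "inj_on c ?B"
    using inj ST inj_on_subset by blast+
  ultimately have "inj_on c (?A \<union> ?B)"
    by (auto simp: inj_on_Un)
  then have "card (c ` (?A \<union> ?B)) = card (?A \<union> ?B)"
    by (rule card_image)
  also have "\<dots> = card A + card B"
    using AB fin by (metis \<open>card A + card B = card (A \<union> B)\<close> card_image image_Un inj_Inl)
  finally have "card A + card B = card (c ` (?A \<union> ?B))" ..
  also have "\<dots> \<le> card (c ` S)"
  proof (rule card_mono)
    show "finite (c ` S)"
      using finH sub[OF \<open>S \<in> \<P>\<close>] by (meson finite_imageI finite_subset)
    have "c ` (?A \<union> ?B) \<subseteq> c ` pverts H"
      using ST sub by blast
    also have "\<dots> \<subseteq> c ` S"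
      using ex1[OF _ \<open>S \<in> \<P>\<close>] by (metis image_eqI subsetI)
    finally show "c ` (?A \<union> ?B) \<subseteq> c ` S" .
  qed
  also have "\<dots> = k"
    using \<P> ST inj by (simp add: card_image)
  finally show False
    using k by simp
qed

text \<open>For this block size no isolated vertices are added and the only possible block is the
  whole vertex set, so any injective coloring does.\<close>

lemma strongly_colorable_card_pverts:
  assumes fin: "finite (pverts G)" and loopfree: "\<And>v. (v, v) \<notin> parcs G"
    and wf: "parcs G \<subseteq> pverts G \<times> pverts G"
  shows "strongly_colorable G (card (pverts G))"
proof -
  define n where "n = card (pverts G)"
  let ?H = "add_isolated G 0"
  have l: "(LEAST l. n dvd l + n) = 0"
    by (rule Least_equality) auto
  have H: "pverts ?H = Inl ` pverts G"
    by (auto simp: add_isolated_def)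
  have finH: "finite (pverts ?H)" and cardH: "card (pverts ?H) = n"
    using fin by (auto simp: H n_def card_image)
  obtain c :: "'a + nat \<Rightarrow> nat" where c: "inj_on c (pverts ?H)"
    using finH finite_imp_inj_to_nat_seg by blast
  have "proper_coloring ?H c"
    unfolding proper_coloring_def
  proof clarify
    fix u v assume uv: "(u, v) \<in> parcs ?H" and "c u = c v"
    moreover from uv have "u \<in> pverts ?H" "v \<in> pverts ?H"
      using wf by (auto simp: add_isolated_def)
    ultimately have "u = v"
      using c by (simp add: inj_on_def)
    with uv show False
      using loopfree by (auto simp: add_isolated_def)
  qed
  moreover have "\<exists>!v. v \<in> S \<and> c v = x"
    if "partition_on (pverts ?H) \<P>" "\<forall>S\<in>\<P>. card S = n" "x \<in> c ` pverts ?H" "S \<in> \<P>" for \<P> S x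
  proof -
    have "S \<subseteq> pverts ?H"
      using that by (auto simp: partition_on_def)
    then have "S = pverts ?H"
      using that finH cardH by (simp add: card_subset_eq)
    then show ?thesis
      using that(3) c by (auto simp: inj_on_def)
  qed
  ultimately show ?thesis
    unfolding strongly_colorable_def Let_def n_def[symmetric] l by blast
qed

text \<open>The parts are the fibres of \<open>f\<close>. Two different ones are required, since an
  edgeless graph has strong chromatic number 1.\<close>

lemma strong_chromatic_number_complete_multipartite:
  assumes fin: "finite (pverts G)"
    and arcs: "parcs G = {(u, v). u \<in> pverts G \<and> v \<in> pverts G \<and> f u \<noteq> f v}"
    and fibre: "\<And>v. v \<in> pverts G \<Longrightarrow> card {u \<in> pverts G. f u = f v} = m"
    and two: "a \<in> pverts G" "b \<in> pverts G" "f a \<noteq> f b"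
  shows "strong_chromatic_number G = card (pverts G)"
proof -
  let ?V = "pverts G"
  have card_vimage: "card {u \<in> ?V. f u \<in> Z} = card Z * m" if "Z \<subseteq> f ` ?V" for Z
  proof -
    have "finite Z"
      using that fin by (meson finite_imageI finite_subset)
    have "{u \<in> ?V. f u \<in> Z} = (\<Union>z\<in>Z. {u \<in> ?V. f u = z})"
      by auto
    also have "card \<dots> = (\<Sum>z\<in>Z. card {u \<in> ?V. f u = z})"
      using fin \<open>finite Z\<close> by (intro card_UN_disjoint) auto
    also have "\<dots> = (\<Sum>z\<in>Z. m)"
      using that fibre by (intro sum.cong) auto
    finally show ?thesis by simp
  qed
  have "\<not> strongly_colorable G k" if k: "0 < k" "k < card ?V" for k
  proof (cases "k < m")
    case True
    then obtain A where A: "A \<subseteq> {u \<in> ?V. f u = f a}" "card A = k"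
      using fibre[OF two(1)] by (metis less_imp_le obtain_subset_with_card_n)
    have "(u, b) \<in> parcs G" if "u \<in> A" for u
      using that A two by (auto simp: arcs)
    moreover have "b \<notin> A"
      using A two by auto
    ultimately show ?thesis
      using A k two by (intro not_strongly_colorable[OF fin, of k A "{b}"]) auto
  next
    case False
    have "a \<in> {u \<in> ?V. f u = f a}"
      using two by simp
    then have "card {u \<in> ?V. f u = f a} > 0"
      using fin by (subst card_gt_0_iff) auto
    then have "m > 0"
      using fibre[OF two(1)] by simp
    \<comment> \<open>\<open>s\<close> whole parts fit into \<open>k\<close> vertices, and
      \<open>k < card ?V\<close> leaves a further part. That part has \<open>m\<close> vertices, at
      most \<open>k\<close> in this case, and together with the \<open>s\<close> parts it exceeds
      \<open>k\<close>.\<close>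
    define s where "s = k div m"
    have "card ?V = card (f ` ?V) * m"
      using card_vimage[of "f ` ?V"] by (simp add: Collect_conj_eq[symmetric] cong: conj_cong)
    with k have "s < card (f ` ?V)"
      by (simp add: s_def \<open>m > 0\<close> less_mult_imp_div_less)
    then obtain Z where Z: "Z \<subseteq> f ` ?V" "card Z = s"
      by (meson less_imp_le obtain_subset_with_card_n)
    with \<open>s < card (f ` ?V)\<close> have "Z \<noteq> f ` ?V"
      by auto
    with Z obtain z where z: "z \<in> f ` ?V" "z \<notin> Z"
      by auto
    let ?A = "{u \<in> ?V. f u \<in> Z}" and ?B = "{u \<in> ?V. f u = z}"
    have cX: "card ?A = k div m * m" and cY: "card ?B = m"
      using card_vimage[OF Z(1)] Z fibre z by (auto simp: s_def)
    moreover have "k < k div m * m + m"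
      using \<open>m > 0\<close> by (metis add.commute dividend_less_div_times)
    ultimately show ?thesis
      using False k z by (intro not_strongly_colorable[OF fin, of k ?A ?B]) (auto simp: arcs)
  qed
  moreover have "strongly_colorable G (card ?V)"
    using two by (intro strongly_colorable_card_pverts fin) (auto simp: arcs)
  moreover have "card ?V > 0"
    using fin two by (auto simp: card_gt_0_iff)
  ultimately show ?thesis
    unfolding strong_chromatic_number_def by (intro Least_equality) (simp, meson not_le)
qed


section \<open>Local principality of primes\<close>

lemma set_add_memI: "a \<in> A \<Longrightarrow> b \<in> B \<Longrightarrow> a \<oplus>\<^bsub>R\<^esub> b \<in> A <+>\<^bsub>R\<^esub> B"
  unfolding set_add_def' by blast

section \<open>The ascending chain condition\<close>

text \<open>In a noetherian ring a nonempty chain of ideals contains its union, which thus serves as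
  the upper bound in Zorn's lemma.\<close>

lemma (in noetherian_ring) exists_maximal_ideal_in:
  assumes "\<A> \<noteq> {}" "\<And>I. I \<in> \<A> \<Longrightarrow> ideal I R"
  shows "\<exists>M\<in>\<A>. \<forall>I\<in>\<A>. M \<subseteq> I \<longrightarrow> I = M"
proof (rule subset_Zorn_nonempty[OF assms(1)])
  fix \<C> assume "\<C> \<noteq> {}" and chain: "subset.chain \<A> \<C>"
  have "subset.chain {I. ideal I R} \<C>"
    using chain assms(2) by (auto simp: subset.chain_def)
  with \<open>\<C> \<noteq> {}\<close> have "\<Union>\<C> \<in> \<C>"
    by (rule ideal_chain_is_trivial)
  then show "\<Union>\<C> \<in> \<A>"
    using chain by (auto simp: subset.chain_def)
qed

lemma (in noetherian_ring) ascending_ideals_stabilize: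
  assumes "\<And>n. ideal (J n) R" "\<And>n. J n \<subseteq> J (Suc n)"
  obtains n :: nat where "J (Suc n) = J n"
proof -
  obtain M where "M \<in> range J" and max: "\<forall>I\<in>range J. M \<subseteq> I \<longrightarrow> I = M"
    using exists_maximal_ideal_in[of "range J"] assms(1) by blast
  then obtain n where "M = J n"
    by blast
  with max assms(2)[of n] have "J (Suc n) = J n"
    by blast
  then show thesis
    by (rule that)
qed

section \<open>Ideal quotients and integral closure\<close>

lemma (in cring) idealI':
  assumes "I \<subseteq> carrier R" "\<zero> \<in> I"
    and add: "\<And>x y. x \<in> I \<Longrightarrow> y \<in> I \<Longrightarrow> x \<oplus> y \<in> I"
    and mult: "\<And>r x. r \<in> carrier R \<Longrightarrow> x \<in> I \<Longrightarrow> r \<otimes> x \<in> I"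
  shows "ideal I R"
proof (rule idealI)
  show "subgroup I (add_monoid R)"
  proof (rule add.subgroupI)
    fix x assume "x \<in> I"
    then have "\<ominus> x = (\<ominus> \<one>) \<otimes> x"
      using assms(1) by (simp add: l_minus subset_iff)
    also have "\<dots> \<in> I"
      using \<open>x \<in> I\<close> by (simp add: mult)
    finally show "\<ominus> x \<in> I" .
  qed (use assms in auto)
next
  fix x r assume "x \<in> I" "r \<in> carrier R"
  then show "r \<otimes> x \<in> I" "x \<otimes> r \<in> I"
    using mult[of r x] assms(1) by (auto simp: m_comm subset_iff)
qed (rule ring_axioms)

text \<open>The ideal quotient (I : b). In a domain, for \<open>I = PIdl a\<close> with
  \<open>a\<close> nonzero, it is the ideal of denominators of the fraction b/a.\<close>

definition colon :: "('a, 'b) ring_scheme \<Rightarrow> 'a set \<Rightarrow> 'a \<Rightarrow> 'a set" where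
  "colon R I b = {x \<in> carrier R. x \<otimes>\<^bsub>R\<^esub> b \<in> I}"

lemma (in cring) colon_ideal:
  assumes "ideal I R" "b \<in> carrier R"
  shows "ideal (colon R I b) R"
proof -
  interpret I: ideal I R by fact
  show ?thesis
    using assms(2) by (intro idealI') (auto simp: colon_def l_distr m_assoc I.I_l_closed)
qed

text \<open>Since \<open>z\<^sub>n = z\<^sub>0 (b/a)\<^sup>n\<close>, stabilization of the ascending chain of the ideals generated by
  \<open>z\<^sub>0, \<dots>, z\<^sub>n\<^sub>-\<^sub>1\<close> yields a monic equation for \<open>b/a\<close>, without any determinants.\<close>

lemma (in noetherian_domain) integrally_closed_imp_dvd:
  assumes ic: "integrally_closed R"
    and ab: "a \<in> carrier R" "b \<in> carrier R" "a \<noteq> \<zero>"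
    and z: "\<And>n. z n \<in> carrier R" "\<And>n. a \<otimes> z (Suc n) = b \<otimes> z n" "z 0 \<noteq> \<zero>"
  shows "b \<in> PIdl a"
proof -
  obtain K :: "('a \<times> 'a) set ring" and \<phi> where K: "is_fraction_field R K \<phi>"
    and closed: "\<And>x. x \<in> carrier K \<Longrightarrow> integral_over K (\<phi> ` carrier R) x \<Longrightarrow> x \<in> \<phi> ` carrier R"
    using ic unfolding integrally_closed_def by blast
  interpret K: field K
    using K by (simp add: is_fraction_field_def)
  have inj: "inj_on \<phi> (carrier R)" and "\<phi> \<in> ring_hom R K"
    using K by (simp_all add: is_fraction_field_def)
  interpret \<phi>: ring_hom_ring R K \<phi>
    using \<open>\<phi> \<in> ring_hom R K\<close> by unfold_locales
  have nz: "\<phi> x \<noteq> \<zero>\<^bsub>K\<^esub>" if "x \<in> carrier R" "x \<noteq> \<zero>" for x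
    using inj that by (metis \<phi>.hom_zero inj_onD zero_closed)
  define y where "y = \<phi> b \<otimes>\<^bsub>K\<^esub> inv\<^bsub>K\<^esub> (\<phi> a)"
  have ia: "inv\<^bsub>K\<^esub> (\<phi> a) \<in> carrier K" "\<phi> a \<otimes>\<^bsub>K\<^esub> inv\<^bsub>K\<^esub> (\<phi> a) = \<one>\<^bsub>K\<^esub>"
    using ab nz K.field_Units by auto
  have y: "y \<in> carrier K" "\<phi> a \<otimes>\<^bsub>K\<^esub> y = \<phi> b"
  proof -
    show "y \<in> carrier K"
      using ab ia by (simp add: y_def)
    have "\<phi> a \<otimes>\<^bsub>K\<^esub> y = \<phi> b \<otimes>\<^bsub>K\<^esub> (\<phi> a \<otimes>\<^bsub>K\<^esub> inv\<^bsub>K\<^esub> (\<phi> a))"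
      using ab ia(1) by (simp add: y_def K.m_lcomm)
    then show "\<phi> a \<otimes>\<^bsub>K\<^esub> y = \<phi> b"
      using ab ia by simp
  qed
  have \<phi>z: "\<phi> (z n) = \<phi> (z 0) \<otimes>\<^bsub>K\<^esub> y [^]\<^bsub>K\<^esub> n" for n
  proof (induction n)
    case (Suc n)
    have "\<phi> a \<otimes>\<^bsub>K\<^esub> \<phi> (z (Suc n)) = \<phi> b \<otimes>\<^bsub>K\<^esub> \<phi> (z n)"
      using z ab by (metis \<phi>.hom_mult)
    also have "\<dots> = \<phi> a \<otimes>\<^bsub>K\<^esub> (y \<otimes>\<^bsub>K\<^esub> (\<phi> (z 0) \<otimes>\<^bsub>K\<^esub> y [^]\<^bsub>K\<^esub> n))"
      using z ab y(1) by (simp add: Suc K.m_assoc flip: y(2))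
    also have "\<dots> = \<phi> a \<otimes>\<^bsub>K\<^esub> (\<phi> (z 0) \<otimes>\<^bsub>K\<^esub> y [^]\<^bsub>K\<^esub> Suc n)"
      using z y(1) by (simp add: K.m_ac)
    finally show ?case
      using z ab y(1) nz by (subst (asm) K.m_lcancel) auto
  qed (use z in simp)
  define J where "J = rec_nat {\<zero>} (\<lambda>n I. I <+> PIdl (z n))"
  have J: "J 0 = {\<zero>}" "\<And>n. J (Suc n) = J n <+> PIdl (z n)"
    by (simp_all add: J_def)
  have idJ: "ideal (J n) R" for n
    by (induction n) (simp_all add: J zeroideal add_ideals cgenideal_ideal z)
  have zJ: "J n \<subseteq> J (Suc n)" "z n \<in> J (Suc n)" for n
  proof -
    interpret Jn: ideal "J n" R by (rule idJ)
    interpret Z: ideal "PIdl (z n)" R by (simp add: cgenideal_ideal z)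
    have "x \<oplus> \<zero> \<in> J (Suc n)" if "x \<in> J n" for x
      using that Z.zero_closed unfolding J by (rule set_add_memI)
    then show "J n \<subseteq> J (Suc n)"
      using Jn.a_subset by auto
    have "\<zero> \<oplus> z n \<in> J (Suc n)"
      using Jn.zero_closed cgenideal_self[OF z(1)] unfolding J by (rule set_add_memI)
    then show "z n \<in> J (Suc n)"
      using z by simp
  qed
  \<comment> \<open>The list \<open>p\<close> holds \<open>n\<close> coefficients, possibly with
    leading zeros, so an entry prepended to it becomes the coefficient of \<open>y [^] n\<close>.
    The sign is chosen for the cancellation at the end.\<close>
  have rep: "\<exists>p. length p = n \<and> set p \<subseteq> \<phi> ` carrier R
      \<and> \<phi> (z 0) \<otimes>\<^bsub>K\<^esub> K.eval p y = \<ominus>\<^bsub>K\<^esub> \<phi> x" if "x \<in> J n" for n x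
    using that
  proof (induction n arbitrary: x)
    case 0
    then show ?case
      using z by (auto simp: J)
  next
    case (Suc n)
    then obtain x' r where x': "x' \<in> J n" and r: "r \<in> carrier R" and x: "x = x' \<oplus> r \<otimes> z n"
      unfolding J set_add_def' cgenideal_def by blast
    obtain p where p: "length p = n" "set p \<subseteq> \<phi> ` carrier R"
      "\<phi> (z 0) \<otimes>\<^bsub>K\<^esub> K.eval p y = \<ominus>\<^bsub>K\<^esub> \<phi> x'"
      using Suc.IH[OF x'] by blast
    have x'c: "x' \<in> carrier R"
      using x' ideal.Icarr[OF idJ] by blast
    have ev: "K.eval p y \<in> carrier K"
      using p y by (intro K.eval_in_carrier) auto
    have "\<phi> (z 0) \<otimes>\<^bsub>K\<^esub> K.eval (\<phi> (\<ominus> r) # p) y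
        = \<phi> (z 0) \<otimes>\<^bsub>K\<^esub> (\<phi> (\<ominus> r) \<otimes>\<^bsub>K\<^esub> y [^]\<^bsub>K\<^esub> n) \<oplus>\<^bsub>K\<^esub> \<ominus>\<^bsub>K\<^esub> \<phi> x'"
      using p z y r ev by (simp add: K.r_distr)
    also have "\<phi> (z 0) \<otimes>\<^bsub>K\<^esub> (\<phi> (\<ominus> r) \<otimes>\<^bsub>K\<^esub> y [^]\<^bsub>K\<^esub> n) = \<phi> (\<ominus> r) \<otimes>\<^bsub>K\<^esub> \<phi> (z n)"
      using z y r by (simp add: \<phi>z[of n] K.m_lcomm del: \<phi>.hom_a_inv)
    also have "\<dots> \<oplus>\<^bsub>K\<^esub> \<ominus>\<^bsub>K\<^esub> \<phi> x' = \<ominus>\<^bsub>K\<^esub> \<phi> x"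
      using z r x'c by (simp add: x K.l_minus K.minus_add K.a_comm)
    finally show ?case
      using p r by (intro exI[of _ "\<phi> (\<ominus> r) # p"]) (auto simp del: \<phi>.hom_a_inv)
  qed
  obtain n where "J (Suc n) = J n"
    using ascending_ideals_stabilize[of J] idJ zJ by blast
  \<comment> \<open>As the chain is stationary here, \<open>z n\<close> already lies in
    \<open>J n\<close>. Prepending one to its list adds \<open>\<phi> (z n)\<close>, which cancels
    the negative; the nonzero factor \<open>\<phi> (z 0)\<close> is then dropped.\<close>
  then obtain p where p: "length p = n" "set p \<subseteq> \<phi> ` carrier R"
    "\<phi> (z 0) \<otimes>\<^bsub>K\<^esub> K.eval p y = \<ominus>\<^bsub>K\<^esub> \<phi> (z n)"
    using rep zJ by metis
  have ev: "K.eval p y \<in> carrier K"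
    using p y by (intro K.eval_in_carrier) auto
  have "\<phi> (z 0) \<otimes>\<^bsub>K\<^esub> K.eval (\<one>\<^bsub>K\<^esub> # p) y = \<phi> (z n) \<oplus>\<^bsub>K\<^esub> \<ominus>\<^bsub>K\<^esub> \<phi> (z n)"
    using p y z ev by (simp add: K.r_distr flip: \<phi>z)
  also have "\<dots> = \<zero>\<^bsub>K\<^esub>"
    using z by (simp add: K.r_neg)
  finally have "K.eval (\<one>\<^bsub>K\<^esub> # p) y = \<zero>\<^bsub>K\<^esub>"
    using z nz[of "z 0"] y ev by (subst (asm) K.integral_iff) auto
  moreover have "\<one>\<^bsub>K\<^esub> # p \<in> carrier (univ_poly K (\<phi> ` carrier R))"
    using p \<phi>.hom_one by (auto simp: univ_poly_def polynomial_def intro: image_eqI[of _ _ \<one>])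
  ultimately have "integral_over K (\<phi> ` carrier R) y"
    unfolding integral_over_def by force
  then obtain d where d: "d \<in> carrier R" "y = \<phi> d"
    using closed y by blast
  then have "\<phi> (d \<otimes> a) = \<phi> b"
    using y ab by (simp add: K.m_comm)
  then have "d \<otimes> a = b"
    using inj d ab by (simp add: inj_on_def)
  then show ?thesis
    using d by (auto simp: cgenideal_def)
qed

text \<open>For \<open>0 \<noteq> a \<in> P\<close>, a maximal element among the ideals \<open>(aR : b)\<close> contained in \<open>P\<close> is prime, hence
  equal to \<open>P\<close>. For such \<open>b\<close> not every quotient \<open>bx/a\<close> with \<open>x \<in> P\<close> lies in \<open>P\<close>, since otherwise the
  elements \<open>a(b/a)\<^sup>n\<close> would show that \<open>b/a\<close> is integral over \<open>R\<close>.\<close>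

lemma (in noetherian_domain) primeideal_locally_principal:
  assumes ic: "integrally_closed R"
    and dim: "\<And>Q. primeideal Q R \<Longrightarrow> Q \<noteq> {\<zero>} \<Longrightarrow> maximalideal Q R"
    and P: "primeideal P R" "P \<noteq> {\<zero>}"
  obtains p u where "p \<in> P" "u \<in> carrier R" "u \<notin> P" "\<forall>x\<in>P. u \<otimes> x \<in> PIdl p"
proof -
  interpret P: primeideal P R by fact
  have "\<one> \<notin> P"
    using P.one_imp_carrier P.I_notcarr by blast
  obtain a where a: "a \<in> P" "a \<noteq> \<zero>"
    using P(2) P.zero_closed by blast
  then have ac: "a \<in> carrier R"
    by simp
  interpret A: ideal "PIdl a" R
    using ac by (rule cgenideal_ideal)
  let ?C = "colon R (PIdl a)"
  define \<A> where "\<A> = {?C b | b. b \<in> carrier R \<and> ?C b \<subseteq> P}"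
  \<comment> \<open>Here \<open>?C \<one>\<close> is \<open>PIdl a\<close> itself.\<close>
  have "?C \<one> \<subseteq> P"
    using cgenideal_minimal[OF P.is_ideal a(1)] by (auto simp: colon_def)
  then have nonempty: "\<A> \<noteq> {}"
    by (auto simp: \<A>_def)
  have ideals: "ideal I R" if "I \<in> \<A>" for I
    using that colon_ideal[OF A.is_ideal] by (auto simp: \<A>_def)
  obtain M where "M \<in> \<A>" and max: "\<forall>I\<in>\<A>. M \<subseteq> I \<longrightarrow> I = M"
    using exists_maximal_ideal_in[OF nonempty ideals] by blast
  then obtain b where b: "b \<in> carrier R" "M = ?C b" "?C b \<subseteq> P"
    by (auto simp: \<A>_def)
  have idM: "ideal M R"
    using colon_ideal[OF A.is_ideal b(1)] b(2) by simp
  have mono: "M \<subseteq> ?C (s \<otimes> b)" if s: "s \<in> carrier R" for s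
  proof
    fix x assume "x \<in> M"
    then have x: "x \<in> carrier R" "x \<otimes> b \<in> PIdl a"
      by (auto simp: b(2) colon_def)
    then have "x \<otimes> (s \<otimes> b) = s \<otimes> (x \<otimes> b)"
      using b(1) s by (simp add: m_lcomm)
    also have "\<dots> \<in> PIdl a"
      using A.I_l_closed x(2) s .
    finally show "x \<in> ?C (s \<otimes> b)"
      using x by (simp add: colon_def)
  qed
  \<comment> \<open>Multiplying \<open>b\<close> by an element outside the prime \<open>P\<close>
    keeps the quotient inside \<open>P\<close>, so maximality prevents it from growing.\<close>
  have saturated: "?C (s \<otimes> b) = M" if s: "s \<in> carrier R" "s \<notin> P" for s
  proof (rule max[rule_format])
    have "?C (s \<otimes> b) \<subseteq> P"
    proof
      fix t assume "t \<in> ?C (s \<otimes> b)"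
      then have "t \<in> carrier R" "t \<otimes> s \<in> ?C b"
        using s b(1) by (auto simp: colon_def m_assoc)
      then show "t \<in> P"
        using b(3) s P.I_prime by blast
    qed
    then show "?C (s \<otimes> b) \<in> \<A>"
      using s b(1) by (auto simp: \<A>_def)
  qed (rule mono[OF s(1)])
  have "primeideal M R"
  proof (rule primeidealI[OF idM is_cring])
    show "carrier R \<noteq> M"
      using b(2,3) \<open>\<one> \<notin> P\<close> one_closed by blast
  next
    fix x y assume xy: "x \<in> carrier R" "y \<in> carrier R" "x \<otimes> y \<in> M"
    \<comment> \<open>For \<open>y\<close> outside \<open>M\<close>, the quotient of
      \<open>x \<otimes> b\<close> properly contains \<open>M\<close>, so by maximality it leaves
      \<open>P\<close>. An \<open>s\<close> outside \<open>P\<close> in that quotient puts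
      \<open>x\<close> into \<open>?C (s \<otimes> b)\<close>, which equals
      \<open>M\<close>.\<close>
    have "x \<in> M" if "y \<notin> M"
    proof -
      have "y \<in> ?C (x \<otimes> b)"
        using xy b(1) by (simp add: b(2) colon_def) (metis m_assoc m_comm)
      with that have "?C (x \<otimes> b) \<noteq> M"
        by blast
      moreover have "?C (x \<otimes> b) \<in> \<A>" if "?C (x \<otimes> b) \<subseteq> P"
        using that xy b(1) by (auto simp: \<A>_def)
      ultimately have "\<not> ?C (x \<otimes> b) \<subseteq> P"
        using max mono[OF xy(1)] by blast
      then obtain s where s: "s \<in> carrier R" "s \<notin> P" "s \<otimes> (x \<otimes> b) \<in> PIdl a"
        by (auto simp: colon_def)
      then have "x \<in> ?C (s \<otimes> b)"
        using xy b(1) by (simp add: colon_def m_lcomm)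
      then show "x \<in> M"
        using saturated s by simp
    qed
    then show "x \<in> M \<or> y \<in> M"
      by blast
  qed
  moreover have "a \<in> M"
    using b cgenideal_self[OF ac] ac A.I_r_closed by (simp add: colon_def)
  ultimately have "maximalideal M R"
    using dim a by blast
  \<comment> \<open>\<open>M\<close> is maximal and lies in the proper ideal
    \<open>P\<close>.\<close>
  then have "P = M"
    using b P.is_ideal P.a_subset P.I_notcarr maximalideal.I_maximal by metis
  then have "P = ?C b"
    using b(2) by simp
  with \<open>\<one> \<notin> P\<close> have "\<one> \<notin> ?C b"
    by blast
  then have "b \<notin> PIdl a"
    using b(1) by (simp add: colon_def)
  have "\<exists>y\<in>carrier R. b \<otimes> x = a \<otimes> y" if "x \<in> P" for x
  proof -
    have "x \<in> ?C b"
      using that \<open>P = ?C b\<close> by blast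
    then obtain y where "x \<in> carrier R" "y \<in> carrier R" "x \<otimes> b = y \<otimes> a"
      unfolding colon_def cgenideal_def by blast
    then show ?thesis
      using b(1) ac by (metis m_comm)
  qed
  \<comment> \<open>\<open>f x\<close> is the fraction bx/a.\<close>
  then obtain f where f: "\<And>x. x \<in> P \<Longrightarrow> f x \<in> carrier R" "\<And>x. x \<in> P \<Longrightarrow> b \<otimes> x = a \<otimes> f x"
    by metis
  have "\<exists>p\<in>P. f p \<notin> P"
  proof (rule ccontr)
    assume "\<not> (\<exists>p\<in>P. f p \<notin> P)"
    then have zP: "(f ^^ n) a \<in> P" for n
      by (induction n) (use a in auto)
    have "b \<in> PIdl a"
      using zP f a by (intro integrally_closed_imp_dvd[OF ic ac b(1) a(2), of "\<lambda>n. (f ^^ n) a"]) auto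
    with \<open>b \<notin> PIdl a\<close> show False ..
  qed
  then obtain p where p: "p \<in> P" "f p \<notin> P"
    by blast
  \<comment> \<open>The multiplier sought is \<open>f p\<close>, that is bp/a: its product with
    \<open>x\<close> is (bx/a)p, a multiple of \<open>p\<close>.\<close>
  show thesis
  proof (rule that[OF p(1) f(1)[OF p(1)] p(2)], rule ballI)
    fix x assume x: "x \<in> P"
    have "a \<otimes> (f p \<otimes> x) = (b \<otimes> p) \<otimes> x"
      using f[OF p(1)] ac x by (simp add: m_assoc)
    also have "\<dots> = p \<otimes> (b \<otimes> x)"
      using b(1) p(1) x by (simp add: m_ac)
    also have "\<dots> = a \<otimes> (f x \<otimes> p)"
      using f[OF x] ac p(1) x by (simp add: m_ac)
    finally have "f p \<otimes> x = f x \<otimes> p"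
      using ac a(2) f(1)[OF p(1)] f(1)[OF x] p(1) x by (subst (asm) m_lcancel) simp_all
    then show "f p \<otimes> x \<in> PIdl p"
      using f(1)[OF x] unfolding cgenideal_def by blast
  qed
qed


section \<open>Residue rings of prime powers\<close>

lemma ideals_set_simps [simp]:
  "\<one>\<^bsub>ideals_set R\<^esub> = carrier R"
  "I \<otimes>\<^bsub>ideals_set R\<^esub> J = ideal_prod R I J"
  by (simp_all add: ideals_set_def)

lemma (in cring) ideal_pow_ideal:
  assumes "ideal P R"
  shows "ideal (P [^]\<^bsub>ideals_set R\<^esub> (n::nat)) R"
  by (induction n) (simp_all add: oneideal ideal_prod_is_ideal assms)

lemma (in cring) ideal_pow_Suc_subset:
  assumes "ideal P R"
  shows "P [^]\<^bsub>ideals_set R\<^esub> Suc n \<subseteq> (P [^]\<^bsub>ideals_set R\<^esub> n)" "P [^]\<^bsub>ideals_set R\<^esub> Suc n \<subseteq> P"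
  using ideal_prod_inter[OF ideal_pow_ideal[OF assms] assms, of n] by auto

lemma (in cring) nat_pow_mem_ideal_pow:
  assumes "ideal P R" "p \<in> P"
  shows "p [^] n \<in> P [^]\<^bsub>ideals_set R\<^esub> (n::nat)"
  by (induction n) (simp_all add: assms ideal_prod.prod)

text \<open>Each factor from \<open>P\<close> in a product becomes a multiple of \<open>p\<close> at
  the price of one \<open>u\<close>, and multiples of \<open>p [^] n\<close> are closed under
  sums.\<close>

lemma (in cring) pow_mult_ideal_pow:
  assumes P: "ideal P R" "p \<in> P" and u: "u \<in> carrier R" "\<forall>x\<in>P. u \<otimes> x \<in> PIdl p"
    and x: "x \<in> P [^]\<^bsub>ideals_set R\<^esub> (n::nat)"
  shows "u [^] n \<otimes> x \<in> PIdl (p [^] n)"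
  using x
proof (induction n arbitrary: x)
  case 0
  then show ?case
    by (auto simp: cgenideal_def intro!: exI[of _ x])
next
  case (Suc n)
  have p: "p \<in> carrier R"
    using P by (rule ideal.Icarr)
  have idn: "ideal (P [^]\<^bsub>ideals_set R\<^esub> n) R"
    using P(1) by (rule ideal_pow_ideal)
  have carr: "x \<in> carrier R" if "x \<in> (P [^]\<^bsub>ideals_set R\<^esub> n) \<cdot> P" for x
    using ideal_prod_in_carrier[OF idn P(1)] that by blast
  have idp: "ideal (PIdl (p [^] Suc n)) R"
    using p by (intro cgenideal_ideal) simp
  have "x \<in> (P [^]\<^bsub>ideals_set R\<^esub> n) \<cdot> P"
    using Suc.prems by simp
  then show ?case
  proof (induction x rule: ideal_prod.induct)
    case (prod i j)
    obtain r where r: "r \<in> carrier R" "u [^] n \<otimes> i = r \<otimes> p [^] n"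
      using Suc.IH[OF prod(1)] unfolding cgenideal_def by blast
    obtain s where s: "s \<in> carrier R" "u \<otimes> j = s \<otimes> p"
      using bspec[OF u(2) prod(2)] unfolding cgenideal_def by blast
    have ij: "i \<in> carrier R" "j \<in> carrier R"
      using ideal.Icarr[OF idn prod(1)] ideal.Icarr[OF P(1) prod(2)] .
    have "u [^] Suc n \<otimes> (i \<otimes> j) = (u [^] n \<otimes> i) \<otimes> (u \<otimes> j)"
      using ij u(1) by (simp add: m_ac)
    also have "\<dots> = (r \<otimes> s) \<otimes> p [^] Suc n"
      using r s p by (simp add: m_ac)
    finally show ?case
      using r(1) s(1) unfolding cgenideal_def by blast
  next
    case (sum x y)
    then have "u [^] Suc n \<otimes> (x \<oplus> y) = u [^] Suc n \<otimes> x \<oplus> u [^] Suc n \<otimes> y"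
      using carr u(1) by (intro r_distr) auto
    then show ?case
      using sum.IH additive_subgroup.a_closed[OF ideal.axioms(1)[OF idp]] by simp
  qed
qed

section \<open>Inverses modulo powers of a maximal ideal\<close>

text \<open>By maximality, \<open>x\<close> and \<open>I\<close> together generate the whole
  ring.\<close>

lemma (in maximalideal) exists_inverse_mod:
  assumes "cring R" "x \<in> carrier R" "x \<notin> I"
  shows "\<exists>v\<in>carrier R. \<exists>w\<in>I. v \<otimes> x \<oplus> w = \<one>"
proof -
  interpret cring R by fact
  interpret J: ideal "PIdl x" R
    using assms by (simp add: cgenideal_ideal)
  interpret S: ideal "PIdl x <+>\<^bsub>R\<^esub> I" R
    using J.is_ideal is_ideal by (rule add_ideals)
  have "\<zero> \<oplus> y \<in> PIdl x <+>\<^bsub>R\<^esub> I" if "y \<in> I" for y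
    using J.zero_closed that by (rule set_add_memI)
  then have "I \<subseteq> PIdl x <+>\<^bsub>R\<^esub> I"
    by auto
  moreover have "x \<oplus> \<zero> \<in> PIdl x <+>\<^bsub>R\<^esub> I"
    using cgenideal_self[OF assms(2)] additive_subgroup.zero_closed[OF additive_subgroup_axioms]
    by (rule set_add_memI)
  then have "PIdl x <+>\<^bsub>R\<^esub> I \<noteq> I"
    using assms(2,3) by (metis r_zero)
  ultimately have "PIdl x <+>\<^bsub>R\<^esub> I = carrier R"
    using I_maximal[OF S.is_ideal] S.a_subset by blast
  then have "\<one> \<in> PIdl x <+>\<^bsub>R\<^esub> I"
    by simp
  then show ?thesis
    unfolding set_add_def' cgenideal_def by force
qed

text \<open>Multiply the relation for the \<open>n\<close>-th power by the one for \<open>I\<close>: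
  the term \<open>w \<otimes> w'\<close> lies in the next power, and all other terms are multiples
  of \<open>x\<close>.\<close>

lemma (in maximalideal) exists_inverse_mod_pow:
  assumes "cring R" "x \<in> carrier R" "x \<notin> I"
  shows "\<exists>v\<in>carrier R. \<exists>w \<in> I [^]\<^bsub>ideals_set R\<^esub> (n::nat). v \<otimes> x \<oplus> w = \<one>"
proof (induction n)
  case 0
  interpret cring R by fact
  \<comment> \<open>The zeroth power is the whole ring, so \<open>w\<close> may be one minus
    \<open>x\<close>.\<close>
  show ?case
    using assms by (intro bexI[of _ \<one>] bexI[of _ "\<ominus> x \<oplus> \<one>"]) (auto simp: r_neg2)
next
  case (Suc n)
  interpret cring R by fact
  obtain v w where v: "v \<in> carrier R" and w: "w \<in> I [^]\<^bsub>ideals_set R\<^esub> n" and vw: "v \<otimes> x \<oplus> w = \<one>"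
    using Suc by blast
  obtain v' w' where v': "v' \<in> carrier R" and w': "w' \<in> I" and vw': "v' \<otimes> x \<oplus> w' = \<one>"
    using exists_inverse_mod[OF assms] by blast
  have carr: "w \<in> carrier R" "w' \<in> carrier R"
    using w w' ideal.Icarr[OF ideal_pow_ideal[OF is_ideal]] by auto
  have "\<one> = (v \<otimes> x \<oplus> w) \<otimes> (v' \<otimes> x \<oplus> w')"
    by (simp add: vw vw')
  also have "\<dots> = (v \<otimes> x \<otimes> v' \<oplus> v \<otimes> w' \<oplus> w \<otimes> v') \<otimes> x \<oplus> w \<otimes> w'"
    using v v' carr assms(2) by algebra
  finally show ?case
    using v v' carr assms(2) ideal_prod.prod[OF w w']
    by (intro bexI[of _ "v \<otimes> x \<otimes> v' \<oplus> v \<otimes> w' \<oplus> w \<otimes> v'"] bexI[of _ "w \<otimes> w'"])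
      simp_all
qed

section \<open>The number of residue classes modulo a prime power\<close>

text \<open>Working with elements instead of cosets allows representatives for different ideals to
  be combined by ring operations.\<close>

lemma (in ring) obtain_coset_representatives:
  assumes "ideal I R"
  obtains T where "T \<subseteq> carrier R" "card T = card (carrier (R Quot I))"
    "\<forall>x\<in>carrier R. \<exists>t\<in>T. x \<ominus> t \<in> I" "\<forall>s\<in>T. \<forall>t\<in>T. s \<ominus> t \<in> I \<longrightarrow> s = t"
proof -
  have carrier: "carrier (R Quot I) = (+>) I ` carrier R"
    by (auto simp: FactRing_simps)
  obtain T where T: "T \<subseteq> carrier R" "inj_on ((+>) I) T" "carrier (R Quot I) = (+>) I ` T"
    using carrier by (metis order_refl subset_image_inj)
  have "\<exists>t\<in>T. x \<ominus> t \<in> I" if x: "x \<in> carrier R" for x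
  proof -
    have "I +> x \<in> (+>) I ` T"
      using x carrier T(3) by blast
    then show ?thesis
      using quotient_eq_iff_same_a_r_cos[OF assms x] T(1) by blast
  qed
  moreover have "s = t" if "s \<in> T" "t \<in> T" "s \<ominus> t \<in> I" for s t
    using that T(1,2) quotient_eq_iff_same_a_r_cos[OF assms, of s t] by (auto dest: inj_onD)
  moreover have "card T = card (carrier (R Quot I))"
    using T(2,3) by (simp add: card_image)
  ultimately show thesis
    using T(1) by (intro that[of T]) blast+
qed

text \<open>With \<open>t\<close> running over representatives modulo the \<open>n\<close>-th power
  and \<open>s\<close> over those modulo \<open>P\<close>, the sums
  \<open>t \<oplus> p [^] n \<otimes> s\<close> represent each class modulo the next power exactly
  once.\<close>

lemma (in domain) card_quot_ideal_pow:
  assumes P: "primeideal P R" "maximalideal P R" "P \<noteq> {\<zero>}"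
    and p: "p \<in> P" and u: "u \<in> carrier R" "u \<notin> P" "\<forall>x\<in>P. u \<otimes> x \<in> PIdl p"
  shows "card (carrier (R Quot (P [^]\<^bsub>ideals_set R\<^esub> n))) = card (carrier (R Quot P)) ^ n"
proof (induction n)
  case 0
  have "carrier (R Quot carrier R) = {carrier R}"
  proof -
    interpret ideal "carrier R" R by (rule oneideal)
    show ?thesis
      using a_rcos_const by (auto simp: FactRing_simps)
  qed
  then show ?case
    by simp
next
  case (Suc n)
  interpret P: primeideal P R by fact
  let ?I = "P [^]\<^bsub>ideals_set R\<^esub> n" and ?J = "P [^]\<^bsub>ideals_set R\<^esub> Suc n"
  have I: "ideal ?I R" and J: "ideal ?J R"
    by (rule ideal_pow_ideal[OF P.is_ideal])+
  have pc: "p \<in> carrier R"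
    using p by simp
  have pn: "p [^] n \<in> carrier R" "p [^] n \<in> ?I"
    using pc nat_pow_mem_ideal_pow[OF P.is_ideal p] by auto
  \<comment> \<open>Otherwise the nonzero \<open>u\<close> would annihilate all of
    \<open>P\<close>.\<close>
  have "p \<noteq> \<zero>"
  proof
    assume "p = \<zero>"
    obtain x where x: "x \<in> P" "x \<noteq> \<zero>"
      using P(3) P.zero_closed by blast
    have "u \<otimes> x = \<zero>"
      using bspec[OF u(3) x(1)] \<open>p = \<zero>\<close> by (auto simp: cgenideal_def)
    with x u show False
      using integral_iff P.zero_closed P.Icarr by metis
  qed
  then have pn0: "p [^] n \<noteq> \<zero>"
    using pc by (induction n) (auto simp: integral_iff)
  have upow: "u [^] m \<notin> P" for m :: nat
  proof (induction m)
    case 0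
    then show ?case
      using P.one_imp_carrier P.I_notcarr by auto
  next
    case (Suc m)
    then show ?case
      using u P.I_prime[of "u [^] m" u] by auto
  qed
  \<comment> \<open>Surjectivity of multiplication by \<open>p [^] n\<close>: with \<open>v\<close>
    inverse to \<open>u [^] n\<close> modulo \<open>P\<close>, \<open>x\<close> differs from
    \<open>v \<otimes> (u [^] n \<otimes> x)\<close> by \<open>x \<otimes> w\<close>, which lies in
    \<open>?J\<close>, and \<open>u [^] n \<otimes> x\<close> is a multiple of
    \<open>p [^] n\<close>.\<close>
  have generate: "\<exists>r\<in>carrier R. x \<ominus> p [^] n \<otimes> r \<in> ?J" if x: "x \<in> ?I" for x
  proof -
    obtain v w where v: "v \<in> carrier R" and w: "w \<in> P" and vw: "v \<otimes> u [^] n \<oplus> w = \<one>"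
      using maximalideal.exists_inverse_mod[OF P(2) is_cring _ upow[of n]] u(1) by auto
    obtain s where s: "s \<in> carrier R" "u [^] n \<otimes> x = s \<otimes> p [^] n"
      using pow_mult_ideal_pow[OF P.is_ideal p u(1,3) x] unfolding cgenideal_def by blast
    have xc: "x \<in> carrier R" and wc: "w \<in> carrier R"
      using ideal.Icarr[OF I x] w by auto
    have "x = (v \<otimes> u [^] n \<oplus> w) \<otimes> x"
      using xc by (simp add: vw)
    also have "\<dots> = v \<otimes> (u [^] n \<otimes> x) \<oplus> x \<otimes> w"
      using xc wc v u(1) by (simp add: l_distr m_assoc m_comm[of w])
    also have "\<dots> = p [^] n \<otimes> (v \<otimes> s) \<oplus> x \<otimes> w"
      using v s pn by (simp add: m_ac)
    finally have "x \<ominus> p [^] n \<otimes> (v \<otimes> s) = x \<otimes> w"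
      using xc wc v s(1) pn(1) by (metis a_comm add.inv_solve_right' m_closed minus_eq)
    also have "\<dots> \<in> ?J"
      using ideal_prod.prod[OF x w] by simp
    finally show ?thesis
      using v s(1) by blast
  qed
  \<comment> \<open>Injectivity: multiplication by \<open>u [^] Suc n\<close> gives a multiple of
    \<open>p [^] Suc n\<close>. Cancelling \<open>p [^] n\<close> leaves
    \<open>u [^] Suc n \<otimes> x\<close> in the prime \<open>P\<close>, which does not contain the
    power of \<open>u\<close>.\<close>
  have cancel: "x \<in> P" if x: "x \<in> carrier R" "p [^] n \<otimes> x \<in> ?J" for x
  proof -
    obtain s where s: "s \<in> carrier R" "u [^] Suc n \<otimes> (p [^] n \<otimes> x) = s \<otimes> p [^] Suc n"
      using pow_mult_ideal_pow[OF P.is_ideal p u(1,3) x(2)] unfolding cgenideal_def by blast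
    have uc: "u [^] Suc n \<in> carrier R"
      using u(1) by simp
    have "p [^] n \<otimes> (u [^] Suc n \<otimes> x) = p [^] n \<otimes> (s \<otimes> p)"
      using s x(1) pc uc pn(1) by (metis m_lcomm nat_pow_Suc)
    then have "u [^] Suc n \<otimes> x = s \<otimes> p"
      using pn0 s(1) x(1) pc uc pn(1) by (metis m_closed m_lcancel)
    then have "u [^] Suc n \<otimes> x \<in> P"
      using s(1) p P.I_l_closed by simp
    then show "x \<in> P"
      using P.I_prime[OF uc x(1)] upow[of "Suc n"] by blast
  qed
  obtain S where S: "S \<subseteq> carrier R" "card S = card (carrier (R Quot P))"
    "\<forall>x\<in>carrier R. \<exists>t\<in>S. x \<ominus> t \<in> P" "\<forall>s\<in>S. \<forall>t\<in>S. s \<ominus> t \<in> P \<longrightarrow> s = t"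
    using obtain_coset_representatives[OF P.is_ideal] .
  obtain T where T: "T \<subseteq> carrier R" "card T = card (carrier (R Quot ?I))"
    "\<forall>x\<in>carrier R. \<exists>t\<in>T. x \<ominus> t \<in> ?I" "\<forall>s\<in>T. \<forall>t\<in>T. s \<ominus> t \<in> ?I \<longrightarrow> s = t"
    using obtain_coset_representatives[OF I] .
  let ?f = "\<lambda>(t, s). ?J +> (t \<oplus> p [^] n \<otimes> s)"
  have "bij_betw ?f (T \<times> S) (carrier (R Quot ?J))"
    unfolding bij_betw_def
  proof (intro conjI inj_onI)
    fix ts ts' assume ts: "ts \<in> T \<times> S" "ts' \<in> T \<times> S" "?f ts = ?f ts'"
    obtain t s t' s' where eq: "ts = (t, s)" "ts' = (t', s')"
      by fastforce
    have mem: "t \<in> T" "s \<in> S" "t' \<in> T" "s' \<in> S"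
      using ts eq by auto
    then have carr: "t \<in> carrier R" "s \<in> carrier R" "t' \<in> carrier R" "s' \<in> carrier R"
      using S(1) T(1) by auto
    have "(t \<oplus> p [^] n \<otimes> s) \<ominus> (t' \<oplus> p [^] n \<otimes> s') \<in> ?J"
      using ts(3) carr pn(1) by (subst quotient_eq_iff_same_a_r_cos[OF J]) (auto simp: eq)
    also have "(t \<oplus> p [^] n \<otimes> s) \<ominus> (t' \<oplus> p [^] n \<otimes> s') = (t \<ominus> t') \<oplus> p [^] n \<otimes> (s \<ominus> s')"
      using carr pn(1) by algebra
    finally have *: "(t \<ominus> t') \<oplus> p [^] n \<otimes> (s \<ominus> s') \<in> ?J" .
    interpret I: ideal ?I R by (rule I)
    have pI: "p [^] n \<otimes> (s \<ominus> s') \<in> ?I"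
      using pn(2) carr by (intro I.I_r_closed) auto
    \<comment> \<open>Reading the difference modulo the larger ideal \<open>?I\<close> first
      identifies \<open>t\<close> with \<open>t'\<close>; then \<open>cancel\<close> applies to
      \<open>s\<close> and \<open>s'\<close>.\<close>
    have "(t \<ominus> t') \<oplus> p [^] n \<otimes> (s \<ominus> s') \<in> ?I"
      using * ideal_pow_Suc_subset(1)[OF P.is_ideal] by blast
    then have "((t \<ominus> t') \<oplus> p [^] n \<otimes> (s \<ominus> s')) \<oplus> \<ominus> (p [^] n \<otimes> (s \<ominus> s')) \<in> ?I"
      using pI by blast
    also have "((t \<ominus> t') \<oplus> p [^] n \<otimes> (s \<ominus> s')) \<oplus> \<ominus> (p [^] n \<otimes> (s \<ominus> s')) = t \<ominus> t'"
      using carr pn(1) by algebra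
    finally have "t = t'"
      using T(4) mem by blast
    with * carr pn(1) have "p [^] n \<otimes> (s \<ominus> s') \<in> ?J"
      by (simp add: r_neg minus_eq)
    then have "s \<ominus> s' \<in> P"
      using cancel carr by simp
    then have "s = s'"
      using S(4) mem by blast
    with \<open>t = t'\<close> show "ts = ts'"
      by (simp add: eq)
  next
    have "?f ts \<in> carrier (R Quot ?J)" if "ts \<in> T \<times> S" for ts
      using that S(1) T(1) pn(1) by (auto simp: FactRing_simps)
    moreover have "C \<in> ?f ` (T \<times> S)" if "C \<in> carrier (R Quot ?J)" for C
    proof -
      obtain x where x: "x \<in> carrier R" "C = ?J +> x"
        using \<open>C \<in> carrier (R Quot ?J)\<close> by (auto simp: FactRing_simps)
      \<comment> \<open>Successive approximation of \<open>x\<close>: \<open>t\<close> fits modulo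
        \<open>?I\<close>, \<open>r\<close> corrects the error modulo \<open>?J\<close>, and
        \<open>r\<close> may be replaced by its representative \<open>s\<close>, since
        \<open>p [^] n\<close> times an element of \<open>P\<close> lies in
        \<open>?J\<close>.\<close>
      obtain t where t: "t \<in> T" "x \<ominus> t \<in> ?I"
        using T(3) x(1) by blast
      obtain r where r: "r \<in> carrier R" "(x \<ominus> t) \<ominus> p [^] n \<otimes> r \<in> ?J"
        using generate[OF t(2)] by blast
      obtain s where s: "s \<in> S" "r \<ominus> s \<in> P"
        using S(3) r(1) by blast
      have carr: "t \<in> carrier R" "s \<in> carrier R"
        using s t S(1) T(1) by auto
      have "p [^] n \<otimes> (r \<ominus> s) \<in> ?J"
        using ideal_prod.prod[OF pn(2) s(2)] by simp
      then have "((x \<ominus> t) \<ominus> p [^] n \<otimes> r) \<oplus> p [^] n \<otimes> (r \<ominus> s) \<in> ?J"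
        using r(2) additive_subgroup.a_closed[OF ideal.axioms(1)[OF J]] by blast
      also have "((x \<ominus> t) \<ominus> p [^] n \<otimes> r) \<oplus> p [^] n \<otimes> (r \<ominus> s) = x \<ominus> (t \<oplus> p [^] n \<otimes> s)"
        using x(1) r(1) carr pn(1) by algebra
      finally have "C = ?f (t, s)"
        using x r(1) carr pn(1) by (subst (asm) quotient_eq_iff_same_a_r_cos[OF J]) auto
      then show ?thesis
        using s t by blast
    qed
    ultimately show "?f ` (T \<times> S) = carrier (R Quot ?J)"
      by blast
  qed
  then have "card (carrier (R Quot ?J)) = card (T \<times> S)"
    by (simp add: bij_betw_same_card)
  also have "\<dots> = card (carrier (R Quot P)) ^ Suc n"
    by (simp add: card_cartesian_product T(2) S(2) Suc)
  finally show ?case .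
qed

section \<open>Unitary Cayley graphs of local rings\<close>

text \<open>A difference is a unit exactly when the two elements lie in different cosets of
  \<open>M\<close>, so these equally large cosets are the parts of a complete multipartite
  graph.\<close>

lemma (in cring) strong_chromatic_number_local:
  assumes fin: "finite (carrier R)" and M: "ideal M R" "Units R = carrier R - M"
  shows "strong_chromatic_number (unitary_cayley_graph R) = card (carrier R)"
proof -
  interpret M: ideal M R by fact
  let ?G = "unitary_cayley_graph R"
  have V: "pverts ?G = carrier R"
    by (simp add: unitary_cayley_graph_def)
  have "strong_chromatic_number ?G = card (pverts ?G)"
  proof (rule strong_chromatic_number_complete_multipartite[where f = "(+>) M" and m = "card M"])
    show "finite (pverts ?G)"
      using fin by (simp add: V)
    show "parcs ?G = {(u, v). u \<in> pverts ?G \<and> v \<in> pverts ?G \<and> M +> u \<noteq> M +> v}"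
      by (auto simp: unitary_cayley_graph_def M(2) quotient_eq_iff_same_a_r_cos[OF M(1)])
    show "card {u \<in> pverts ?G. M +> u = M +> v} = card M" if "v \<in> pverts ?G" for v
    proof -
      have v: "v \<in> carrier R"
        using that by (simp add: V)
      have "{u \<in> carrier R. M +> u = M +> v} = M +> v"
        using v M.a_rcos_self M.a_repr_independence' M.a_elemrcos_carrier by blast
      moreover have "M +> v \<in> a_rcosets M"
        using v M.a_subset by (intro a_rcosetsI)
      ultimately show ?thesis
        using fin M.a_subset by (simp add: V a_card_cosets_equal)
    qed
    show "\<one> \<in> pverts ?G" "\<zero> \<in> pverts ?G"
      by (simp_all add: V)
    have "\<one> \<ominus> \<zero> \<notin> M"
      using Units_one_closed M(2) by (simp add: minus_eq)
    then show "M +> \<one> \<noteq> M +> \<zero>"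
      using quotient_eq_iff_same_a_r_cos[OF M(1)] by blast
  qed
  then show ?thesis
    by (simp add: V)
qed

text \<open>Elements outside \<open>I\<close> have inverses modulo every power of \<open>I\<close>.
  Elements of \<open>I\<close> have none modulo \<open>J\<close>, since \<open>J\<close> lies in the
  proper ideal \<open>I\<close>.\<close>

lemma (in maximalideal) Units_quot_ideal_pow:
  assumes "cring R" "n > 0"
  defines "J \<equiv> I [^]\<^bsub>ideals_set R\<^esub> (n::nat)"
  shows "Units (R Quot J) = carrier (R Quot J) - (+>) J ` I"
proof -
  interpret cring R by fact
  interpret J: ideal J R
    unfolding J_def using is_ideal by (rule ideal_pow_ideal)
  interpret Q: cring "R Quot J"
    using is_cring by (rule J.quotient_is_cring)
  \<comment> \<open>Positivity of \<open>n\<close> enters here: the zeroth power is the whole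
    ring.\<close>
  have "J \<subseteq> I"
    using ideal_pow_Suc_subset(2)[OF is_ideal, of "n - 1"] \<open>n > 0\<close> by (simp add: J_def)
  have "\<one> \<notin> I"
    using one_imp_carrier I_notcarr by blast
  have carrier: "carrier (R Quot J) = (+>) J ` carrier R"
    by (auto simp: FactRing_simps)
  have mult: "(J +> x) \<otimes>\<^bsub>R Quot J\<^esub> (J +> y) = J +> x \<otimes> y"
    if "x \<in> carrier R" "y \<in> carrier R" for x y
    using J.rcoset_mult_add[OF that] by (simp add: FactRing_def)
  have one: "\<one>\<^bsub>R Quot J\<^esub> = J +> \<one>"
    by (simp add: FactRing_def)
  \<comment> \<open>As \<open>J\<close> lies in \<open>I\<close>, membership in \<open>I\<close>
    depends only on the coset modulo \<open>J\<close>.\<close>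
  have mem: "J +> x \<in> (+>) J ` I \<longleftrightarrow> x \<in> I" if x: "x \<in> carrier R" for x
  proof
    assume "J +> x \<in> (+>) J ` I"
    then obtain y where y: "y \<in> I" "J +> x = J +> y"
      by blast
    then have "x \<ominus> y \<in> I"
      using quotient_eq_iff_same_a_r_cos[OF J.is_ideal x, of y] \<open>J \<subseteq> I\<close> by auto
    then have "(x \<ominus> y) \<oplus> y \<in> I"
      using y(1) by (rule additive_subgroup.a_closed[OF ideal.axioms(1)[OF is_ideal]])
    then show "x \<in> I"
      using x y(1) by (simp add: minus_eq a_assoc l_neg)
  qed blast
  have units: "J +> x \<in> Units (R Quot J) \<longleftrightarrow> x \<notin> I" if x: "x \<in> carrier R" for x
  proof
    assume "J +> x \<in> Units (R Quot J)"
    then obtain D where "D \<in> carrier (R Quot J)" "(J +> x) \<otimes>\<^bsub>R Quot J\<^esub> D = \<one>\<^bsub>R Quot J\<^esub>"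
      unfolding Units_def by blast
    then obtain y where y: "y \<in> carrier R" "J +> x \<otimes> y = J +> \<one>"
      using mult[OF x] one by (auto simp: carrier)
    then have "x \<otimes> y \<ominus> \<one> \<in> I"
      using quotient_eq_iff_same_a_r_cos[OF J.is_ideal, of "x \<otimes> y" \<one>] x \<open>J \<subseteq> I\<close> by auto
    show "x \<notin> I"
    proof
      assume "x \<in> I"
      then have "x \<otimes> y \<oplus> \<ominus> (x \<otimes> y \<ominus> \<one>) \<in> I"
        using \<open>x \<otimes> y \<ominus> \<one> \<in> I\<close> y(1) I_r_closed by blast
      moreover have "x \<otimes> y \<oplus> \<ominus> (x \<otimes> y \<ominus> \<one>) = \<one>"
        using x y(1) by algebra
      ultimately show False
        using \<open>\<one> \<notin> I\<close> by simp
    qed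
  next
    assume "x \<notin> I"
    then obtain v w where v: "v \<in> carrier R" and w: "w \<in> J" and vw: "v \<otimes> x \<oplus> w = \<one>"
      using exists_inverse_mod_pow[OF is_cring x, of n] unfolding J_def by blast
    have "v \<otimes> x \<ominus> \<one> = \<ominus> w"
      unfolding vw[symmetric] using v w x J.Icarr by algebra
    then have "J +> v \<otimes> x = J +> \<one>"
      using quotient_eq_iff_same_a_r_cos[OF J.is_ideal, of "v \<otimes> x" \<one>] v w x by simp
    then have "(J +> x) \<otimes>\<^bsub>R Quot J\<^esub> (J +> v) = \<one>\<^bsub>R Quot J\<^esub>"
      using mult[OF x v] one m_comm[OF x v] by simp
    then show "J +> x \<in> Units (R Quot J)"
      using v x Q.Units_one_closed by (intro Q.unit_factor[of "J +> x" "J +> v"]) (simp_all add: carrier)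
  qed
  have "C \<in> Units (R Quot J) \<longleftrightarrow> C \<in> carrier (R Quot J) - (+>) J ` I" for C
  proof (cases "C \<in> carrier (R Quot J)")
    case True
    then obtain x where "x \<in> carrier R" "C = J +> x"
      unfolding carrier by (elim imageE)
    with True units[of x] mem[of x] show ?thesis
      by simp
  next
    case False
    then show ?thesis
      using Q.Units_closed[of C] by blast
  qed
  then show ?thesis
    by (rule Set.set_eqI)
qed

theorem theorem5p1:
  fixes R :: "('a, 'b) ring_scheme" and P :: "'a set" and \<alpha> :: nat
  assumes "dedekind_domain R"
    and "primeideal P R" and "P \<noteq> {\<zero>\<^bsub>R\<^esub>}"
    and "finite (carrier (R Quot P))"
    and "\<alpha> > 0"
  shows "strong_chromatic_number (unitary_cayley_graph (R Quot (P [^]\<^bsub>ideals_set R\<^esub> \<alpha>)))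
           = card (carrier (R Quot P)) ^ \<alpha>"
proof -
  let ?J = "P [^]\<^bsub>ideals_set R\<^esub> \<alpha>"
  interpret noetherian_domain R
    using assms(1) by (simp add: dedekind_domain_def)
  have max: "maximalideal Q R" if "primeideal Q R" "Q \<noteq> {\<zero>\<^bsub>R\<^esub>}" for Q
    using assms(1) that by (simp add: dedekind_domain_def)
  have ic: "integrally_closed R"
    using assms(1) by (simp add: dedekind_domain_def)
  interpret P: maximalideal P R
    using assms(2,3) by (rule max)
  interpret J: ideal ?J R
    using P.is_ideal by (rule ideal_pow_ideal)
  interpret Q: cring "R Quot ?J"
    using is_cring by (rule J.quotient_is_cring)
  obtain p u where "p \<in> P" "u \<in> carrier R" "u \<notin> P" "\<forall>x\<in>P. u \<otimes>\<^bsub>R\<^esub> x \<in> PIdl\<^bsub>R\<^esub> p"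
    using primeideal_locally_principal[OF ic max assms(2,3)] .
  then have card: "card (carrier (R Quot ?J)) = card (carrier (R Quot P)) ^ \<alpha>"
    using assms(2,3) P.is_maximalideal by (intro card_quot_ideal_pow)
  have "carrier (R Quot P) \<noteq> {}"
    using ring.ring_simprules(2)[OF P.quotient_is_ring] by blast
  \<comment> \<open>Infinite sets have \<open>card\<close> 0, so finiteness of the quotient follows
    from its positive count.\<close>
  then have "card (carrier (R Quot ?J)) > 0"
    using assms(4) by (simp add: card card_gt_0_iff)
  then have "finite (carrier (R Quot ?J))"
    by (simp add: card_gt_0_iff)
  then have "strong_chromatic_number (unitary_cayley_graph (R Quot ?J)) = card (carrier (R Quot ?J))"
    using ring_ideal_imp_quot_ideal[OF J.is_ideal P.is_ideal]
      P.Units_quot_ideal_pow[OF is_cring assms(5)]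
    by (rule Q.strong_chromatic_number_local)
  also note card
  finally show ?thesis .
qed

end
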